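(* Consider the battery-sharing model described in the context with $n=2$ users, $S=\{-1,1\}^2$, where the net generation process of user $i\in\{1,2\}$ has transition probability matrix $$P_i=\begin{bmatrix}p_i&1-p_i\\1-q_i&q_i\end{bmatrix}$$ (first row/column corresponding to state $+1$, second to state $-1$), and let $\alpha_i=\frac{1-q_i}{2-p_i-q_i}$ be the generation probability of user $i$. If $\alpha_1>\alpha_2$, then the maxmin fair value under efficient policies is $\mathrm{F}_e=\alpha_2-\alpha_1$ for all even battery sizes $b_{\max}$.
   Context: Notation: $[n]=\{1,\dots,n\}$. Net generation. The net generation of user $i$ at discrete time $t$ is $X_i(t)\in\mathbb{Z}$ (positive: surplus; negative: deficit). The vector $X(t)=(X_1(t),\dots,X_n(t))$ is an irreducible discrete-time Markov chain on the finite state space $S$, with $\mathbb{P}[X(t+1)=s\mid X(t)=s]>0$ for all $s\in S$. Battery. A shared battery of capacity $b_{\max}\in\mathbb{N}$ has level $B(t)\in\{0,\dots,b_{\max}\}$ and evolves as $B(t+1)=B(t)+\sum_{i\in[n]}A_i(t)$, where $A_i(t)$ is the energy accepted from user $i$ (if $\ge0$) or supplied to user $i$ (if negative). In state $(x,b)\in S\times\{0,\dots,b_{\max}\}$ the set $A(x,b)$ of allowable actions consists of all integer vectors $(a_1,\dots,a_n)$ with $a_i\in\{0,\dots,x_i\}$ if $x_i\ge0$, $a_i\in\{x_i,\dots,0\}$ if $x_i<0$, and $0\le b+\sum_{i}a_i\le b_{\max}$. A policy is a (possibly randomized, history-dependent) rule choosing at each time $t$ an action in $A(X(t),B(t))$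 as a function of the history up to time $t$; $X$ evolves autonomously, unaffected by actions. Efficient policies. $A_e(x,b)$ is the set of $a\in A(x,b)$ such that: (E1) if $0\le b+\sum_i x_i\le b_{\max}$ then $a=x$; (E2) if $b+\sum_i x_i>b_{\max}$ then $a_i=x_i$ for all $i$ with $x_i<0$, and $b+\sum_i a_i=b_{\max}$; (E3) if $b+\sum_i x_i<0$ then $a_i=x_i$ for all $i$ with $x_i>0$, and $b+\sum_i a_i=0$. $\Phi_e$ is the set of (history-dependent) policies that always choose an action in $A_e(X(t),B(t))$; these are the efficient policies. The net contribution of user $i$ under a policy is $\mathrm{C}_i=\lim_{T\to\infty}\frac1T\sum_{t=0}^T\mathbb{E}[A_i(t)]$, and the maxmin fair value under efficient policies is $\mathrm{F}_e=\max_{\phi\in\Phi_e}\min_{i\in[n]}\mathrm{C}_i$. *)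

theory Defs
  imports "HOL-Probability.Probability"
begin

section \<open>Markov chains on a finite state space\<close>

text \<open>Transition probabilities are given as a kernel: the pmf \<open>K x\<close> is row \<open>x\<close> of the transition
  matrix. \<open>path_law \<mu> K t\<close> is the joint law of \<open>(X(0), \<dots>, X(t))\<close> for the chain with initial law \<open>\<mu>\<close>.\<close>

primrec path_law :: "'s pmf \<Rightarrow> ('s \<Rightarrow> 's pmf) \<Rightarrow> nat \<Rightarrow> 's list pmf" where
  "path_law \<mu> K 0 = map_pmf (\<lambda>x. [x]) \<mu>"
| "path_law \<mu> K (Suc t) =
     bind_pmf (path_law \<mu> K t) (\<lambda>xs. map_pmf (\<lambda>y. xs @ [y]) (K (last xs)))"

definition irreducible_chain :: "'s set \<Rightarrow> ('s \<Rightarrow> 's pmf) \<Rightarrow> bool" where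
  "irreducible_chain S K \<longleftrightarrow>
     (\<forall>x\<in>S. set_pmf (K x) \<subseteq> S) \<and>
     (\<forall>x\<in>S. \<forall>y\<in>S. (x, y) \<in> {(u, v). u \<in> S \<and> pmf (K u) v > 0}\<^sup>*)"

text \<open>The image process \<open>f(X(0)), f(X(1)), \<dots>\<close> of the chain \<open>X\<close> with initial law \<open>\<mu>\<close> and kernel \<open>K\<close>
  is itself a Markov chain, with kernel \<open>Q\<close>: all finite-dimensional laws agree. For a coordinate
  projection \<open>f\<close> nothing is said about the dependence between different coordinates.\<close>

definition image_chain ::
    "('s \<Rightarrow> 'r) \<Rightarrow> 's pmf \<Rightarrow> ('s \<Rightarrow> 's pmf) \<Rightarrow> ('r \<Rightarrow> 'r pmf) \<Rightarrow> bool" where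
  "image_chain f \<mu> K Q \<longleftrightarrow>
     (\<forall>t. map_pmf (map f) (path_law \<mu> K t) = path_law (map_pmf f \<mu>) Q t)"


section \<open>Battery sharing\<close>

text \<open>Users are the elements of a finite type \<open>'n\<close>. A state is a pair of the net generation vector
  and the battery level.\<close>

type_synonym 'n state = "(int ^ 'n) \<times> int"

definition allowable :: "nat \<Rightarrow> int ^ 'n::finite \<Rightarrow> int \<Rightarrow> (int ^ 'n) set" where
  "allowable b_max x b =
     {a. (\<forall>i. if x $ i \<ge> 0 then a $ i \<in> {0..x $ i} else a $ i \<in> {x $ i..0}) \<and>
         0 \<le> b + (\<Sum>i\<in>UNIV. a $ i) \<and> b + (\<Sum>i\<in>UNIV. a $ i) \<le> int b_max}"

definition efficient_actions :: "nat \<Rightarrow> int ^ 'n::finite \<Rightarrow> int \<Rightarrow> (int ^ 'n) set" where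
  "efficient_actions b_max x b =
     {a \<in> allowable b_max x b.
        (0 \<le> b + (\<Sum>i\<in>UNIV. x $ i) \<and> b + (\<Sum>i\<in>UNIV. x $ i) \<le> int b_max \<longrightarrow> a = x) \<and>
        (b + (\<Sum>i\<in>UNIV. x $ i) > int b_max \<longrightarrow>
           (\<forall>i. x $ i < 0 \<longrightarrow> a $ i = x $ i) \<and> b + (\<Sum>i\<in>UNIV. a $ i) = int b_max) \<and>
        (b + (\<Sum>i\<in>UNIV. x $ i) < 0 \<longrightarrow>
           (\<forall>i. x $ i > 0 \<longrightarrow> a $ i = x $ i) \<and> b + (\<Sum>i\<in>UNIV. a $ i) = 0)}"

text \<open>A randomized, history-dependent policy maps the past states and actions (oldest first, so that
  the length of the list is the current time) and the current state to a law on actions. Only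
  histories whose current state lies in \<open>S \<times> {0..b_max}\<close> are constrained, since elsewhere there may
  be no allowable action at all.\<close>

type_synonym 'n policy = "('n state \<times> (int ^ 'n)) list \<Rightarrow> 'n state \<Rightarrow> (int ^ 'n) pmf"

definition efficient_policies :: "(int ^ 'n::finite) set \<Rightarrow> nat \<Rightarrow> 'n policy set" where
  "efficient_policies S b_max =
     {\<phi>. \<forall>past. \<forall>x\<in>S. \<forall>b\<in>{0..int b_max}.
        set_pmf (\<phi> past (x, b)) \<subseteq> efficient_actions b_max x b}"

text \<open>Law of the history at time \<open>t\<close> (past, current state) under policy \<open>\<phi>\<close>, where \<open>\<nu>\<close> is the joint
  law of \<open>(X(0), B(0))\<close>.\<close>

primrec history_law ::
    "((int ^ 'n::finite) \<Rightarrow> (int ^ 'n) pmf) \<Rightarrow> 'n state pmf \<Rightarrow> 'n policy \<Rightarrow> nat \<Rightarrow>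
     (('n state \<times> (int ^ 'n)) list \<times> 'n state) pmf" where
  "history_law K \<nu> \<phi> 0 = map_pmf (\<lambda>s. ([], s)) \<nu>"
| "history_law K \<nu> \<phi> (Suc t) =
     bind_pmf (history_law K \<nu> \<phi> t) (\<lambda>(past, (x, b)).
     bind_pmf (\<phi> past (x, b)) (\<lambda>a.
     bind_pmf (K x) (\<lambda>x'.
     return_pmf (past @ [((x, b), a)], (x', b + (\<Sum>i\<in>UNIV. a $ i))))))"

definition action_law ::
    "((int ^ 'n::finite) \<Rightarrow> (int ^ 'n) pmf) \<Rightarrow> 'n state pmf \<Rightarrow> 'n policy \<Rightarrow> nat \<Rightarrow> (int ^ 'n) pmf" where
  "action_law K \<nu> \<phi> t = bind_pmf (history_law K \<nu> \<phi> t) (\<lambda>(past, s). \<phi> past s)"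

definition average_contribution ::
    "((int ^ 'n::finite) \<Rightarrow> (int ^ 'n) pmf) \<Rightarrow> 'n state pmf \<Rightarrow> 'n policy \<Rightarrow> 'n \<Rightarrow> nat \<Rightarrow> real" where
  "average_contribution K \<nu> \<phi> i T =
     1 / real T *
       (\<Sum>t=0..T. measure_pmf.expectation (action_law K \<nu> \<phi> t) (\<lambda>a. real_of_int (a $ i)))"

definition has_net_contribution ::
    "((int ^ 'n::finite) \<Rightarrow> (int ^ 'n) pmf) \<Rightarrow> 'n state pmf \<Rightarrow> 'n policy \<Rightarrow> 'n \<Rightarrow> real \<Rightarrow> bool" where
  "has_net_contribution K \<nu> \<phi> i c \<longleftrightarrow> average_contribution K \<nu> \<phi> i \<longlonglongrightarrow> c"

text \<open>\<open>v\<close> is the attained maximum, over the efficient policies whose net contributions exist, of the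
  least net contribution.\<close>

definition is_maxmin_fair_value ::
    "(int ^ 'n::finite) set \<Rightarrow> nat \<Rightarrow> ((int ^ 'n) \<Rightarrow> (int ^ 'n) pmf) \<Rightarrow> 'n state pmf \<Rightarrow> real \<Rightarrow> bool" where
  "is_maxmin_fair_value S b_max K \<nu> v \<longleftrightarrow>
     (\<exists>\<phi>\<in>efficient_policies S b_max. \<exists>c.
        (\<forall>i. has_net_contribution K \<nu> \<phi> i (c i)) \<and> v = Min (range c)) \<and>
     (\<forall>\<phi>\<in>efficient_policies S b_max. \<forall>c.
        (\<forall>i. has_net_contribution K \<nu> \<phi> i (c i)) \<longrightarrow> Min (range c) \<le> v)"

definition generation_probability :: "real \<Rightarrow> real \<Rightarrow> real" where
  "generation_probability p q = (1 - q) / (2 - p - q)"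

end

theory Submission
  imports Defs
begin

text \<open>
  Write \<open>g(b) = 1\<close> for odd \<open>b\<close> and \<open>g(b) = 0\<close> for even \<open>b\<close>. As \<open>b_max\<close> is even, an efficient
  action has \<open>a\<^sub>2 - a\<^sub>1 \<noteq> x\<^sub>2 - x\<^sub>1\<close> only in a step that takes the battery from an odd level to an
  extreme, hence even, level, and even levels are never left. So
  \<open>\<bar>(a\<^sub>2 - a\<^sub>1) - (x\<^sub>2 - x\<^sub>1)\<bar> \<le> g(b) - g(b')\<close>, and since \<open>a\<^sub>1 + a\<^sub>2 = b' - b\<close>, both sums telescope.
  Likewise \<open>E[X\<^sub>i] - (2\<alpha>\<^sub>i - 1)\<close> is proportional to an increment of \<open>P(X\<^sub>i = 1)\<close>. Thus under every
  efficient policy \<open>C\<^sub>1 + C\<^sub>2 = 0\<close> and \<open>C\<^sub>2 - C\<^sub>1 = 2(\<alpha>\<^sub>2 - \<alpha>\<^sub>1)\<close>.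
\<close>

section \<open>Sequences with bounded partial sums\<close>

text \<open>A discrepancy of this kind vanishes after division by \<open>T\<close>. The class is
  closed under linear combinations, so all errors can be combined before any limit is taken.\<close>

definition bounded_partial_sums :: "(nat \<Rightarrow> real) \<Rightarrow> bool" where
  "bounded_partial_sums f \<longleftrightarrow> (\<exists>M. \<forall>T. \<bar>\<Sum>t=0..T. f t\<bar> \<le> M)"

lemma bounded_partial_sums_add:
  assumes "bounded_partial_sums f" "bounded_partial_sums g"
  shows "bounded_partial_sums (\<lambda>t. f t + g t)"
proof -
  obtain M N where "\<And>T. \<bar>\<Sum>t=0..T. f t\<bar> \<le> M" "\<And>T. \<bar>\<Sum>t=0..T. g t\<bar> \<le> N"
    using assms unfolding bounded_partial_sums_def by auto
  then have "\<bar>\<Sum>t=0..T. f t + g t\<bar> \<le> M + N" for T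
    unfolding sum.distrib by (meson abs_triangle_ineq add_mono order_trans)
  then show ?thesis unfolding bounded_partial_sums_def by blast
qed

lemma bounded_partial_sums_cmult:
  assumes "bounded_partial_sums f"
  shows "bounded_partial_sums (\<lambda>t. c * f t)"
proof -
  obtain M where "\<And>T. \<bar>\<Sum>t=0..T. f t\<bar> \<le> M"
    using assms unfolding bounded_partial_sums_def by auto
  then have "\<bar>\<Sum>t=0..T. c * f t\<bar> \<le> \<bar>c\<bar> * M" for T
    unfolding sum_distrib_left [symmetric] abs_mult by (simp add: mult_left_mono)
  then show ?thesis unfolding bounded_partial_sums_def by blast
qed

text \<open>Each \<open>\<bar>f t\<bar>\<close> is paid for by a decrease of the potential
  \<open>g\<close>, and a bounded potential can only pay a bounded total.\<close>

lemma bounded_partial_sums_telescope: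
  assumes le: "\<And>t. \<bar>f t\<bar> \<le> g t - g (Suc t)" and bound: "\<And>t. \<bar>g t\<bar> \<le> M"
  shows "bounded_partial_sums f"
proof -
  have "\<bar>\<Sum>t=0..T. f t\<bar> \<le> 2 * M" for T
  proof -
    have "\<bar>\<Sum>t=0..T. f t\<bar> \<le> (\<Sum>t=0..T. g t - g (Suc t))"
      using sum_abs [of f] sum_mono [of "{0..T}" "\<lambda>t. \<bar>f t\<bar>", OF le] by (rule order_trans)
    also have "\<dots> = g 0 - g (Suc T)"
      by (induction T) auto
    also have "\<dots> \<le> 2 * M"
      using bound [of 0] bound [of "Suc T"] by linarith
    finally show ?thesis .
  qed
  then show ?thesis unfolding bounded_partial_sums_def by blast
qed

lemma bounded_partial_sums_increments:
  assumes bound: "\<And>t. \<bar>g t\<bar> \<le> M"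
  shows "bounded_partial_sums (\<lambda>t. g (Suc t) - g t)"
proof -
  have "\<bar>\<Sum>t=0..T. g (Suc t) - g t\<bar> \<le> 2 * M" for T
  proof -
    have "(\<Sum>t=0..T. g (Suc t) - g t) = g (Suc T) - g 0"
      by (induction T) auto
    then show ?thesis
      using bound [of 0] bound [of "Suc T"] by linarith
  qed
  then show ?thesis unfolding bounded_partial_sums_def by blast
qed

lemma average_tendsto_of_bounded_partial_sums:
  assumes "bounded_partial_sums (\<lambda>t. f t - c)"
  shows "(\<lambda>T. 1 / real T * (\<Sum>t=0..T. f t)) \<longlonglongrightarrow> c"
proof -
  obtain M where M: "\<And>T. \<bar>\<Sum>t=0..T. f t - c\<bar> \<le> M"
    using assms unfolding bounded_partial_sums_def by auto
  have "(\<lambda>T. 1 / real T * (\<Sum>t=0..T. f t) - c) \<longlonglongrightarrow> 0"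
  proof (rule Lim_null_comparison)
    show "(\<lambda>T. (M + \<bar>c\<bar>) / real T) \<longlonglongrightarrow> 0"
      by (rule lim_const_over_n)
    show "eventually (\<lambda>T. norm (1 / real T * (\<Sum>t=0..T. f t) - c) \<le> (M + \<bar>c\<bar>) / real T) sequentially"
      using eventually_gt_at_top [of 0]
    proof eventually_elim
      case (elim T)
      \<comment> \<open>The sum has \<open>T + 1\<close> terms but is divided by \<open>T\<close>;
        the surplus term is the extra \<open>c\<close>, whence the constant
        \<open>M + \<bar>c\<bar>\<close>.\<close>
      have "1 / real T * (\<Sum>t=0..T. f t) - c = ((\<Sum>t=0..T. f t - c) + c) / real T"
        using elim by (simp add: sum_subtractf field_simps)
      also have "norm \<dots> \<le> (M + \<bar>c\<bar>) / real T"
        using M [of T] by (simp add: divide_right_mono)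
      finally show ?case .
    qed
  qed
  then show ?thesis by (simp add: LIM_zero_iff)
qed

section \<open>Marginals of the chain\<close>

lemma set_path_law_nonempty: "xs \<in> set_pmf (path_law \<mu> K t) \<Longrightarrow> xs \<noteq> []"
  by (cases t) auto

lemma last_path_law_Suc:
  "map_pmf last (path_law \<mu> K (Suc t)) = bind_pmf (map_pmf last (path_law \<mu> K t)) K"
  by (simp add: map_bind_pmf bind_map_pmf map_pmf_comp)

lemma image_chain_last:
  assumes "image_chain f \<mu> K Q"
  shows "map_pmf f (map_pmf last (path_law \<mu> K t)) = map_pmf last (path_law (map_pmf f \<mu>) Q t)"
proof -
  have "map_pmf f (map_pmf last (path_law \<mu> K t)) = map_pmf (\<lambda>xs. last (map f xs)) (path_law \<mu> K t)"
    unfolding map_pmf_comp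
    by (intro map_pmf_cong refl) (simp add: last_map set_path_law_nonempty)
  also have "\<dots> = map_pmf last (map_pmf (map f) (path_law \<mu> K t))"
    by (simp add: map_pmf_comp)
  finally show ?thesis using assms by (simp add: image_chain_def)
qed

text \<open>A path of positive probability extended by \<open>y\<close> has an image of positive
  probability for the image chain, whose last step is the claim. The path \<open>xs\<close> is
  needed because \<open>image_chain\<close> constrains \<open>Q\<close> only along values that are
  actually reached.\<close>

lemma image_chain_step:
  assumes chain: "image_chain f \<mu> K Q" and xs: "xs \<in> set_pmf (path_law \<mu> K t)"
    and y: "y \<in> set_pmf (K (last xs))"
  shows "f y \<in> set_pmf (Q (f (last xs)))"
proof -
  have "xs @ [y] \<in> set_pmf (path_law \<mu> K (Suc t))"
    using xs y by auto
  then have "map f (xs @ [y]) \<in> set_pmf (map_pmf (map f) (path_law \<mu> K (Suc t)))"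
    unfolding set_map_pmf by (rule imageI)
  also have "map_pmf (map f) (path_law \<mu> K (Suc t)) = path_law (map_pmf f \<mu>) Q (Suc t)"
    using chain by (simp only: image_chain_def)
  finally show ?thesis
    using set_path_law_nonempty [OF xs] by (auto simp: last_map)
qed

text \<open>Otherwise \<open>f\<close> would stay constant along the path from \<open>x\<close> to
  \<open>y\<close> that irreducibility provides.\<close>

lemma image_chain_not_absorbed:
  assumes chain: "image_chain f \<mu> K Q" and irr: "irreducible_chain S K"
    and x: "x \<in> S" "x \<in> set_pmf \<mu>" and y: "y \<in> S" "f y \<noteq> f x"
  shows "\<exists>u\<in>S. \<exists>v\<in>S. f u \<noteq> f v \<and> f v \<in> set_pmf (Q (f u))"
proof (rule ccontr)
  assume const: "\<not> ?thesis"
  have "(x, y) \<in> {(u, v). u \<in> S \<and> pmf (K u) v > 0}\<^sup>*"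
    using irr x y unfolding irreducible_chain_def by blast
  \<comment> \<open>The invariant carries a path of positive probability ending in the current
    state, since \<open>image_chain_step\<close> works only along such paths.\<close>
  then have "y \<in> S \<and> f y = f x \<and> (\<exists>t. \<exists>xs\<in>set_pmf (path_law \<mu> K t). last xs = y)"
  proof (induction rule: rtrancl_induct)
    case base
    have "[x] \<in> set_pmf (path_law \<mu> K 0)" using x by simp
    then show ?case using x by (metis last.simps)
  next
    case (step u v)
    then obtain t xs where xs: "xs \<in> set_pmf (path_law \<mu> K t)" "last xs = u" by blast
    have v: "v \<in> set_pmf (K u)" using step by (simp add: set_pmf_iff)
    have "v \<in> S" using irr v step unfolding irreducible_chain_def by blast
    moreover have "f v \<in> set_pmf (Q (f u))"
      using image_chain_step [OF chain xs(1), of v] xs v by simp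
    then have "f v = f u" using const step.IH \<open>v \<in> S\<close> by metis
    moreover have "xs @ [v] \<in> set_pmf (path_law \<mu> K (Suc t))"
      using xs v by auto
    then have "\<exists>t. \<exists>xs\<in>set_pmf (path_law \<mu> K t). last xs = v" by (metis last_snoc)
    ultimately show ?case using step by simp
  qed
  then show False using y by simp
qed

lemma pmf_Suc_two_state:
  fixes N :: "int pmf"
  assumes "set_pmf N \<subseteq> {- 1, 1}"
  shows "pmf (bind_pmf N Q) 1 = pmf (Q 1) 1 * pmf N 1 + pmf (Q (- 1)) 1 * (1 - pmf N 1)"
proof -
  have "pmf (bind_pmf N Q) 1 = measure_pmf.expectation N (\<lambda>x. pmf (Q x) 1)"
    by (rule pmf_bind)
  \<comment> \<open>Any function on a two-point set is affine in the indicator of one point.\<close>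
  also have "\<dots> = measure_pmf.expectation N
      (\<lambda>x. pmf (Q (- 1)) 1 + (pmf (Q 1) 1 - pmf (Q (- 1)) 1) * indicator {1} x)"
    using assms by (intro integral_cong_AE) (auto simp: AE_measure_pmf_iff)
  also have "\<dots> = pmf (Q (- 1)) 1 + (pmf (Q 1) 1 - pmf (Q (- 1)) 1) * pmf N 1"
    by (simp add: pmf.rep_eq measure_pmf.emeasure_eq_measure)
  finally show ?thesis by (simp add: algebra_simps)
qed

lemma expectation_two_state:
  fixes N :: "int pmf"
  assumes "set_pmf N \<subseteq> {- 1, 1}"
  shows "measure_pmf.expectation N real_of_int = 2 * pmf N 1 - 1"
proof -
  have "measure_pmf.expectation N real_of_int =
      measure_pmf.expectation N (\<lambda>x. 2 * indicator {1} x - 1)"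
    using assms by (intro integral_cong_AE) (auto simp: AE_measure_pmf_iff)
  also have "\<dots> = 2 * pmf N 1 - 1"
    by (simp add: pmf.rep_eq measure_pmf.emeasure_eq_measure)
  finally show ?thesis .
qed

text \<open>With \<open>m t = pmf (N t) 1\<close>, the recursion reads
  \<open>m (Suc t) - m t = (1 - q) - (2 - p - q) * m t\<close>. Hence \<open>m t\<close> minus the
  generation probability is an exact multiple of an increment of \<open>m\<close>, and the mean is
  \<open>2 * m t - 1\<close>.\<close>

lemma two_state_mean_bounded_partial_sums:
  fixes N :: "nat \<Rightarrow> int pmf"
  assumes N: "\<And>t. N (Suc t) = bind_pmf (N t) Q" and supp: "\<And>t. set_pmf (N t) \<subseteq> {- 1, 1}"
    and Q: "pmf (Q 1) 1 = p" "pmf (Q (- 1)) 1 = 1 - q" and nz: "2 - p - q \<noteq> 0"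
  shows "bounded_partial_sums
    (\<lambda>t. measure_pmf.expectation (N t) real_of_int - (2 * generation_probability p q - 1))"
proof -
  have "bounded_partial_sums (\<lambda>t. (- 2 / (2 - p - q)) * (pmf (N (Suc t)) 1 - pmf (N t) 1))"
    by (intro bounded_partial_sums_cmult bounded_partial_sums_increments [where M = 1])
      (simp add: pmf_le_1)
  moreover have "measure_pmf.expectation (N t) real_of_int - (2 * generation_probability p q - 1) =
      (- 2 / (2 - p - q)) * (pmf (N (Suc t)) 1 - pmf (N t) 1)" for t
    using nz unfolding expectation_two_state [OF supp] N pmf_Suc_two_state [OF supp] Q
      generation_probability_def by (simp add: field_simps)
  ultimately show ?thesis by simp
qed

section \<open>Joint law of state and action\<close>

text \<open>Forgets the past but keeps state and action together, so that pointwise inequalities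
  linking \<open>x\<close>, \<open>b\<close> and \<open>a\<close> can be integrated against a single
  law.\<close>

definition state_action_law ::
    "((int ^ 'n::finite) \<Rightarrow> (int ^ 'n) pmf) \<Rightarrow> 'n state pmf \<Rightarrow> 'n policy \<Rightarrow> nat \<Rightarrow>
     ('n state \<times> (int ^ 'n)) pmf" where
  "state_action_law K \<nu> \<phi> t =
     bind_pmf (history_law K \<nu> \<phi> t) (\<lambda>(past, s). map_pmf (Pair s) (\<phi> past s))"

lemma action_law_eq: "action_law K \<nu> \<phi> t = map_pmf snd (state_action_law K \<nu> \<phi> t)"
  unfolding action_law_def state_action_law_def
  by (auto simp: map_bind_pmf map_pmf_comp intro!: bind_pmf_cong)

lemma state_law_eq: "map_pmf fst (state_action_law K \<nu> \<phi> t) = map_pmf snd (history_law K \<nu> \<phi> t)"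
  unfolding state_action_law_def
  by (auto simp: map_bind_pmf map_pmf_comp map_pmf_const map_pmf_def [of snd] intro!: bind_pmf_cong)

lemma state_law_Suc:
  "map_pmf snd (history_law K \<nu> \<phi> (Suc t)) =
     bind_pmf (state_action_law K \<nu> \<phi> t)
       (\<lambda>((x, b), a). map_pmf (\<lambda>x'. (x', b + (\<Sum>i\<in>UNIV. a $ i))) (K x))"
  unfolding state_action_law_def
  by (auto simp: map_bind_pmf bind_map_pmf bind_assoc_pmf map_pmf_def bind_return_pmf
      intro!: bind_pmf_cong)

text \<open>Turns expectations of the next battery level into expectations under the present joint
  law, which is what makes the potentials telescope.\<close>

lemma battery_law_Suc:
  "map_pmf snd (map_pmf fst (state_action_law K \<nu> \<phi> (Suc t))) =
     map_pmf (\<lambda>((x, b), a). b + (\<Sum>i\<in>UNIV. a $ i)) (state_action_law K \<nu> \<phi> t)"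
  unfolding state_law_eq state_law_Suc
  by (auto simp: map_bind_pmf map_pmf_comp map_pmf_const
      map_pmf_def [of "\<lambda>((x, b), a). b + (\<Sum>i\<in>UNIV. a $ i)"] intro!: bind_pmf_cong)

text \<open>The next generation vector is drawn from \<open>K x\<close> whatever the action, so the
  policy drops out in the induction.\<close>

lemma generation_law:
  "map_pmf fst (map_pmf fst (state_action_law K \<nu> \<phi> t)) =
     map_pmf last (path_law (map_pmf fst \<nu>) K t)"
proof (induction t)
  case 0
  show ?case unfolding state_law_eq by (simp add: map_pmf_comp)
next
  case (Suc t)
  have "map_pmf fst (map_pmf fst (state_action_law K \<nu> \<phi> (Suc t))) =
      bind_pmf (map_pmf fst (map_pmf fst (state_action_law K \<nu> \<phi> t))) K"
    unfolding state_law_eq [of _ _ _ "Suc t"] state_law_Suc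
    by (auto simp: map_bind_pmf bind_map_pmf map_pmf_comp intro!: bind_pmf_cong)
  then show ?case unfolding Suc last_path_law_Suc .
qed

text \<open>A policy is constrained only on \<open>S \<times> {0..int b_max}\<close>; allowability
  of its actions keeps the state there.\<close>

lemma set_state_law:
  assumes closed: "\<And>x. x \<in> S \<Longrightarrow> set_pmf (K x) \<subseteq> S"
    and initial: "set_pmf \<nu> \<subseteq> S \<times> {0..int b_max}"
    and eff: "\<phi> \<in> efficient_policies S b_max"
  shows "set_pmf (map_pmf snd (history_law K \<nu> \<phi> t)) \<subseteq> S \<times> {0..int b_max}"
proof (induction t)
  case 0
  show ?case using initial by (auto simp: map_pmf_comp)
next
  case (Suc t)
  show ?case
  proof safe
    fix x' b'
    assume "(x', b') \<in> set_pmf (map_pmf snd (history_law K \<nu> \<phi> (Suc t)))"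
    then obtain past x b a where past: "(past, (x, b)) \<in> set_pmf (history_law K \<nu> \<phi> t)"
      and a: "a \<in> set_pmf (\<phi> past (x, b))" and x': "x' \<in> set_pmf (K x)"
      and b': "b' = b + (\<Sum>i\<in>UNIV. a $ i)"
      by (auto simp: split: prod.splits)
    have xb: "x \<in> S" "b \<in> {0..int b_max}"
      using Suc past by force+
    show "x' \<in> S" using closed xb x' by blast
    have "a \<in> allowable b_max x b"
      using eff xb a unfolding efficient_policies_def efficient_actions_def by blast
    then show "b' \<in> {0..int b_max}"
      unfolding b' allowable_def by simp
  qed
qed

lemma set_state_action_law:
  assumes closed: "\<And>x. x \<in> S \<Longrightarrow> set_pmf (K x) \<subseteq> S"
    and initial: "set_pmf \<nu> \<subseteq> S \<times> {0..int b_max}"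
    and eff: "\<phi> \<in> efficient_policies S b_max"
  shows "set_pmf (state_action_law K \<nu> \<phi> t) \<subseteq>
    {((x, b), a). x \<in> S \<and> b \<in> {0..int b_max} \<and> a \<in> efficient_actions b_max x b}"
proof safe
  fix x b a
  assume "((x, b), a) \<in> set_pmf (state_action_law K \<nu> \<phi> t)"
  then obtain past where past: "(past, (x, b)) \<in> set_pmf (history_law K \<nu> \<phi> t)"
    and a: "a \<in> set_pmf (\<phi> past (x, b))"
    unfolding state_action_law_def by auto
  show xb: "x \<in> S" "b \<in> {0..int b_max}"
    using set_state_law [OF closed initial eff, where t = t] past by force+
  show "a \<in> efficient_actions b_max x b"
    using eff xb a unfolding efficient_policies_def by blast
qed

section \<open>Two users\<close>

text \<open>A unit is refused or left unsupplied to exactly one user only at level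
  \<open>b_max - 1\<close> or \<open>1\<close>, both odd, and the step then ends at an even extreme.
  The bounds on the components of \<open>a\<close> serve to make the joint law finitely
  supported.\<close>

lemma efficient_step_two_users:
  fixes x a :: "int ^ 2"
  assumes x: "\<forall>i. x $ i \<in> {- 1, 1}" and b: "b \<in> {0..int b_max}" and ev: "even b_max"
    and a: "a \<in> efficient_actions b_max x b"
  shows "\<bar>(a $ 2 - a $ 1) - (x $ 2 - x $ 1)\<bar> \<le>
    of_bool (odd b) - (of_bool (odd (b + (a $ 1 + a $ 2))) :: int)"
    and "\<bar>a $ 1\<bar> \<le> 1" and "\<bar>a $ 2\<bar> \<le> 1"
proof -
  obtain k where k: "int b_max = 2 * k"
    using ev by (metis dvd_def int_dvd_int_iff of_nat_numeral)
  have x': "x $ 1 = - 1 \<or> x $ 1 = 1" "x $ 2 = - 1 \<or> x $ 2 = 1"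
    using x by auto
  note a' = a [unfolded efficient_actions_def allowable_def, simplified, unfolded forall_2 sum_2]
  show a1: "\<bar>a $ 1\<bar> \<le> 1" and a2: "\<bar>a $ 2\<bar> \<le> 1"
    using x' a' by (auto split: if_splits)
  show "\<bar>(a $ 2 - a $ 1) - (x $ 2 - x $ 1)\<bar> \<le>
    of_bool (odd b) - (of_bool (odd (b + (a $ 1 + a $ 2))) :: int)"
  proof (cases "0 \<le> b + (x $ 1 + x $ 2) \<and> b + (x $ 1 + x $ 2) \<le> int b_max")
    case True
    then have "a = x" using a' by simp
    \<comment> \<open>The sum \<open>x $ 1 + x $ 2\<close> is even, so parity is preserved and both
      sides are zero.\<close>
    then show ?thesis using x' by auto
  next
    case False
    then consider "b + (x $ 1 + x $ 2) > int b_max" | "b + (x $ 1 + x $ 2) < 0"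
      by linarith
    then show ?thesis
    proof cases
      case 1
      then have x1: "x $ 1 = 1" "x $ 2 = 1" using x' b by auto
      have s: "b + (a $ 1 + a $ 2) = int b_max" using 1 a' by simp
      have "a $ 1 \<in> {0, 1}" "a $ 2 \<in> {0, 1}" using a' x1 by auto
      \<comment> \<open>The capacity left is \<open>0\<close> or \<open>1\<close>. In the second
        case one user is cut by a unit, and evenness of \<open>b_max\<close> makes \<open>b\<close>
        odd.\<close>
      moreover have "odd b" if "b + 1 = 2 * k" using that by presburger
      ultimately show ?thesis using s k x1 1 by auto
    next
      case 2
      then have x1: "x $ 1 = - 1" "x $ 2 = - 1" using x' b by auto
      have s: "b + (a $ 1 + a $ 2) = 0" using 2 a' by simp
      have "a $ 1 \<in> {- 1, 0}" "a $ 2 \<in> {- 1, 0}" using a' x1 by auto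
      then show ?thesis using s x1 2 by auto
    qed
  qed
qed

lemma efficient_actions_nonempty_two_users:
  fixes x :: "int ^ 2"
  assumes x: "\<forall>i. x $ i \<in> {- 1, 1}" and b: "b \<in> {0..int b_max}"
  shows "efficient_actions b_max x b \<noteq> {}"
proof -
  have x': "x $ 1 = - 1 \<or> x $ 1 = 1" "x $ 2 = - 1 \<or> x $ 2 = 1"
    using x by auto
  consider "0 \<le> b + (x $ 1 + x $ 2)" "b + (x $ 1 + x $ 2) \<le> int b_max"
    | "b + (x $ 1 + x $ 2) > int b_max" | "b + (x $ 1 + x $ 2) < 0"
    by linarith
  then show ?thesis
  proof cases
    case 1
    then have "x \<in> efficient_actions b_max x b"
      unfolding efficient_actions_def allowable_def by (auto simp: sum_2)
    then show ?thesis by blast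
  next
    case 2
    then have "x $ 1 = 1" "x $ 2 = 1" "int b_max - b \<in> {0, 1}" using x' b by auto
    \<comment> \<open>All remaining capacity goes to user 1; in the deficit case below, user 1
      likewise receives everything left in the battery.\<close>
    then have "vector [int b_max - b, 0] \<in> efficient_actions b_max x b"
      using b 2 unfolding efficient_actions_def allowable_def by (auto simp: sum_2 forall_2)
    then show ?thesis by blast
  next
    case 3
    then have "x $ 1 = - 1" "x $ 2 = - 1" "b \<in> {0, 1}" using x' b by auto
    then have "vector [- b, 0] \<in> efficient_actions b_max x b"
      using b 3 unfolding efficient_actions_def allowable_def by (auto simp: sum_2 forall_2)
    then show ?thesis by blast
  qed
qed

lemma efficient_policies_nonempty_two_users:
  "efficient_policies {x :: int ^ 2. \<forall>i. x $ i \<in> {- 1, 1}} b_max \<noteq> {}"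
proof -
  have "(SOME a. a \<in> efficient_actions b_max x b) \<in> efficient_actions b_max x b"
    if "\<forall>i. x $ i \<in> {- 1, 1}" "b \<in> {0..int b_max}" for x :: "int ^ 2" and b
    using efficient_actions_nonempty_two_users [OF that] by (simp add: some_in_eq)
  then have "(\<lambda>past (x, b). return_pmf (SOME a. a \<in> efficient_actions b_max x b))
      \<in> efficient_policies {x :: int ^ 2. \<forall>i. x $ i \<in> {- 1, 1}} b_max"
    unfolding efficient_policies_def by auto
  then show ?thesis by blast
qed

text \<open>Integrates the one-step relations. The potentials are the expected battery level for the
  sum of the contributions and the probability of an odd level for their difference.\<close>

lemma efficient_policy_drift_two_users:
  fixes K :: "int ^ 2 \<Rightarrow> (int ^ 2) pmf" and \<nu> :: "2 state pmf" and b_max :: nat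
  defines "S \<equiv> {x :: int ^ 2. \<forall>i. x $ i \<in> {- 1, 1}}"
  defines "A \<equiv> \<lambda>\<phi> t i. measure_pmf.expectation (action_law K \<nu> \<phi> t) (\<lambda>a. real_of_int (a $ i))"
  defines "X \<equiv> \<lambda>t i. measure_pmf.expectation (map_pmf last (path_law (map_pmf fst \<nu>) K t))
    (\<lambda>x. real_of_int (x $ i))"
  assumes closed: "\<And>x. x \<in> S \<Longrightarrow> set_pmf (K x) \<subseteq> S"
    and initial: "set_pmf \<nu> \<subseteq> S \<times> {0..int b_max}"
    and eff: "\<phi> \<in> efficient_policies S b_max" and ev: "even b_max"
  shows "bounded_partial_sums (\<lambda>t. A \<phi> t 1 + A \<phi> t 2)"
    and "bounded_partial_sums (\<lambda>t. (A \<phi> t 2 - A \<phi> t 1) - (X t 2 - X t 1))"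
proof -
  define J where "J = state_action_law K \<nu> \<phi>"
  let ?R = "{((x, b), a). x \<in> S \<and> b \<in> {0..int b_max} \<and> a \<in> efficient_actions b_max x b}"
  have supp: "set_pmf (J t) \<subseteq> ?R" for t
    unfolding J_def by (rule set_state_action_law [OF closed initial eff])
  \<comment> \<open>A finite box containing all states and all efficient actions: the joint law has
    finite support, so every real function is integrable.\<close>
  define F where "F = {x :: int ^ 2. \<forall>i. x $ i \<in> {- 1..1}}"
  have "F = (\<lambda>(u, v). vector [u, v]) ` ({- 1..1} \<times> {- 1..1})"
  proof (intro set_eqI iffI)
    fix x assume "x \<in> F"
    then have "(x $ 1, x $ 2) \<in> {- 1..1} \<times> {- 1..1}" unfolding F_def by blast
    moreover have "x = (\<lambda>(u, v). vector [u, v]) (x $ 1, x $ 2)"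
      by (simp add: vec_eq_iff forall_2)
    ultimately show "x \<in> (\<lambda>(u, v). vector [u, v]) ` ({- 1..1} \<times> {- 1..1})" by blast
  next
    fix x :: "int ^ 2" assume "x \<in> (\<lambda>(u, v). vector [u, v]) ` ({- 1..1 :: int} \<times> {- 1..1 :: int})"
    then show "x \<in> F" unfolding F_def by (auto simp: forall_2)
  qed
  then have "finite F" by simp
  moreover have "?R \<subseteq> (F \<times> {0..int b_max}) \<times> F"
  proof safe
    fix x a b
    assume x: "x \<in> S" and b: "b \<in> {0..int b_max}" and a: "a \<in> efficient_actions b_max x b"
    show "x \<in> F" using x unfolding F_def S_def forall_2 by auto
    show "a \<in> F"
      using efficient_step_two_users(2,3) [OF x [unfolded S_def, simplified mem_Collect_eq] b ev a]
      unfolding F_def forall_2 by auto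
  qed
  ultimately have "finite ?R" by (meson finite_SigmaI finite_atLeastAtMost_int finite_subset)
  then have int: "integrable (measure_pmf (J t)) f" for t and f :: "_ \<Rightarrow> real"
    using supp by (meson finite_subset integrable_measure_pmf_finite)
  have add: "measure_pmf.expectation (J t) f + measure_pmf.expectation (J t) g =
      measure_pmf.expectation (J t) (\<lambda>z. f z + g z)"
    and diff: "measure_pmf.expectation (J t) f - measure_pmf.expectation (J t) g =
      measure_pmf.expectation (J t) (\<lambda>z. f z - g z)" for t and f g :: "_ \<Rightarrow> real"
    by (simp_all add: int)
  have A: "A \<phi> t i = measure_pmf.expectation (J t) (\<lambda>(s, a). real_of_int (a $ i))" for t i
    unfolding A_def action_law_eq J_def by (simp add: case_prod_unfold)
  have X: "X t i = measure_pmf.expectation (J t) (\<lambda>((x, b), a). real_of_int (x $ i))" for t i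
    unfolding X_def generation_law [of K \<nu> \<phi>, symmetric] J_def by (simp add: case_prod_unfold)
  have battery: "measure_pmf.expectation (J (Suc t)) (\<lambda>((x, b), a). h b) =
      measure_pmf.expectation (J t) (\<lambda>((x, b), a). h (b + (a $ 1 + a $ 2)))"
    for t and h :: "int \<Rightarrow> real"
  proof -
    have "measure_pmf.expectation (J (Suc t)) (\<lambda>((x, b), a). h b) =
        measure_pmf.expectation (map_pmf snd (map_pmf fst (J (Suc t)))) h"
      by (simp add: case_prod_unfold)
    also have "\<dots> = measure_pmf.expectation (J t) (\<lambda>((x, b), a). h (b + (a $ 1 + a $ 2)))"
      unfolding J_def battery_law_Suc by (simp add: case_prod_unfold sum_2)
    finally show ?thesis .
  qed
  have bound: "\<bar>measure_pmf.expectation (J t) f\<bar> \<le> M"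
    if "\<And>x b a. b \<in> {0..int b_max} \<Longrightarrow> \<bar>f ((x, b), a)\<bar> \<le> M" for t M and f :: "_ \<Rightarrow> real"
  proof -
    have "\<bar>measure_pmf.expectation (J t) f\<bar> \<le> measure_pmf.expectation (J t) (\<lambda>z. \<bar>f z\<bar>)"
      by (rule integral_abs_bound)
    also have "\<dots> \<le> measure_pmf.expectation (J t) (\<lambda>z. M)"
    proof (intro integral_mono_AE int, unfold AE_measure_pmf_iff, safe)
      fix x b a assume "((x, b), a) \<in> set_pmf (J t)"
      then have "((x, b), a) \<in> ?R" using supp by blast
      then show "\<bar>f ((x, b), a)\<bar> \<le> M" by (intro that) simp
    qed
    finally show ?thesis by simp
  qed
  define B where "B t = measure_pmf.expectation (J t) (\<lambda>((x, b), a). real_of_int b)" for t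
  have "A \<phi> t 1 + A \<phi> t 2 = B (Suc t) - B t" for t
    unfolding B_def battery A add diff by (simp add: case_prod_unfold)
  moreover have "\<bar>B t\<bar> \<le> real b_max" for t
    unfolding B_def by (rule bound) auto
  ultimately show "bounded_partial_sums (\<lambda>t. A \<phi> t 1 + A \<phi> t 2)"
    using bounded_partial_sums_increments [of B "real b_max"] by simp
  \<comment> \<open>The probability that the battery level is odd at time \<open>t\<close>.\<close>
  define G :: "nat \<Rightarrow> real" where
    "G t = measure_pmf.expectation (J t) (\<lambda>((x, b), a). of_bool (odd b))" for t
  have "\<bar>(A \<phi> t 2 - A \<phi> t 1) - (X t 2 - X t 1)\<bar> \<le> G t - G (Suc t)" for t
  proof -
    have "(A \<phi> t 2 - A \<phi> t 1) - (X t 2 - X t 1) = measure_pmf.expectation (J t)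
        (\<lambda>((x, b), a). real_of_int ((a $ 2 - a $ 1) - (x $ 2 - x $ 1)))"
      unfolding A X diff by (simp add: case_prod_unfold)
    also have "\<bar>\<dots>\<bar> \<le> measure_pmf.expectation (J t)
        (\<lambda>z. \<bar>(\<lambda>((x, b), a). real_of_int ((a $ 2 - a $ 1) - (x $ 2 - x $ 1))) z\<bar>)"
      by (rule integral_abs_bound)
    also have "\<dots> \<le> measure_pmf.expectation (J t)
        (\<lambda>((x, b), a). of_bool (odd b) - of_bool (odd (b + (a $ 1 + a $ 2))))"
    proof (intro integral_mono_AE int, unfold AE_measure_pmf_iff, safe)
      fix x b a assume "((x, b), a) \<in> set_pmf (J t)"
      then have "((x, b), a) \<in> ?R" using supp by blast
      then have "\<bar>(a $ 2 - a $ 1) - (x $ 2 - x $ 1)\<bar> \<le>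
          of_bool (odd b) - (of_bool (odd (b + (a $ 1 + a $ 2))) :: int)"
        using efficient_step_two_users(1) [of x b b_max a] ev unfolding S_def by simp
      then have "real_of_int \<bar>(a $ 2 - a $ 1) - (x $ 2 - x $ 1)\<bar> \<le>
          real_of_int (of_bool (odd b) - (of_bool (odd (b + (a $ 1 + a $ 2))) :: int))"
        by (rule of_int_le_iff [THEN iffD2])
      then show "\<bar>real_of_int ((a $ 2 - a $ 1) - (x $ 2 - x $ 1))\<bar> \<le>
          of_bool (odd b) - of_bool (odd (b + (a $ 1 + a $ 2)))"
        by (simp only: of_int_abs of_int_diff of_int_of_bool)
    qed
    also have "\<dots> = G t - G (Suc t)"
      unfolding G_def battery diff by (simp add: case_prod_unfold)
    finally show ?thesis .
  qed
  moreover have "\<bar>G t\<bar> \<le> 1" for t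
    unfolding G_def by (rule bound) auto
  ultimately show "bounded_partial_sums (\<lambda>t. (A \<phi> t 2 - A \<phi> t 1) - (X t 2 - X t 1))"
    by (rule bounded_partial_sums_telescope)
qed

text \<open>The fair value ranges only over policies whose contributions exist; the first conjunct
  shows that this excludes no efficient policy.\<close>

theorem propositionV2:
  fixes S :: "(int ^ 2) set"
    and K :: "int ^ 2 \<Rightarrow> (int ^ 2) pmf"
    and P :: "2 \<Rightarrow> int \<Rightarrow> int pmf"
    and p q \<alpha> :: "2 \<Rightarrow> real"
    and \<nu> :: "2 state pmf"
    and b_max :: nat
  assumes S: "S = {x. \<forall>i. x $ i \<in> {- 1, 1}}"
    and irreducible: "irreducible_chain S K"
    and lazy: "\<And>s. s \<in> S \<Longrightarrow> pmf (K s) s > 0"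
    and initial: "set_pmf \<nu> \<subseteq> S \<times> {0..int b_max}"
    and users: "\<And>i. image_chain (\<lambda>x. x $ i) (map_pmf fst \<nu>) K (P i)"
    and P: "\<And>i. pmf (P i 1) 1 = p i" "\<And>i. pmf (P i 1) (- 1) = 1 - p i"
           "\<And>i. pmf (P i (- 1)) 1 = 1 - q i" "\<And>i. pmf (P i (- 1)) (- 1) = q i"
    and \<alpha>: "\<And>i. \<alpha> i = generation_probability (p i) (q i)"
    and less: "\<alpha> 1 > \<alpha> 2"
    and even: "even b_max"
  shows "(\<forall>\<phi>\<in>efficient_policies S b_max. \<forall>i. \<exists>c. has_net_contribution K \<nu> \<phi> i c) \<and>
         is_maxmin_fair_value S b_max K \<nu> (\<alpha> 2 - \<alpha> 1)"
proof -
  have closed: "set_pmf (K x) \<subseteq> S" if "x \<in> S" for x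
    using irreducible that unfolding irreducible_chain_def by blast
  define X where "X t i = measure_pmf.expectation (map_pmf last (path_law (map_pmf fst \<nu>) K t))
    (\<lambda>x. real_of_int (x $ i))" for t i
  have supp: "set_pmf (map_pmf last (path_law (map_pmf fst \<nu>) K t)) \<subseteq> S" for t
  proof (induction t)
    case 0
    show ?case using initial by (auto simp: map_pmf_comp)
  next
    case (Suc t)
    then show ?case unfolding last_path_law_Suc using closed by fastforce
  qed
  \<comment> \<open>If this vanished, both \<open>p i\<close> and \<open>q i\<close> would be
    \<open>1\<close>, so coordinate \<open>i\<close> would be frozen, against
    irreducibility.\<close>
  have nondegenerate: "2 - p i - q i \<noteq> 0" for i
  proof
    assume pq: "2 - p i - q i = 0"
    have "p i \<le> 1" "q i \<le> 1" using P(1,4) [of i] by (metis pmf_le_1)+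
    then have one: "p i = 1" "q i = 1" using pq by linarith+
    obtain s where s: "s \<in> set_pmf \<nu>" using set_pmf_not_empty by fast
    then have x: "fst s \<in> S" "fst s \<in> set_pmf (map_pmf fst \<nu>)" using initial by auto
    have x_i: "fst s $ j = - 1 \<or> fst s $ j = 1" for j using x(1) S by blast
    \<comment> \<open>The negated initial state differs from the initial one in every coordinate, so
      it serves for each \<open>i\<close>.\<close>
    have y: "- fst s \<in> S"
      unfolding S mem_Collect_eq
    proof
      fix j show "(- fst s) $ j \<in> {- 1, 1}" using x_i [of j] by auto
    qed
    have y_i: "(- fst s) $ i \<noteq> fst s $ i" using x_i [of i] by auto
    obtain u v where uv: "u \<in> S" "v \<in> S" "u $ i \<noteq> v $ i" "v $ i \<in> set_pmf (P i (u $ i))"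
      using image_chain_not_absorbed [OF users irreducible x y y_i] by blast
    have "u $ i \<in> {- 1, 1}" "v $ i \<in> {- 1, 1}" using uv S by blast+
    then have "u $ i = 1 \<and> v $ i = - 1 \<or> u $ i = - 1 \<and> v $ i = 1"
      using uv by auto
    then show False
      using uv(4) P(2,3) [of i] one by (auto simp: set_pmf_iff)
  qed
  have generation: "bounded_partial_sums (\<lambda>t. X t i - (2 * \<alpha> i - 1))" for i
  proof -
    \<comment> \<open>Built from the two-state kernel, \<open>N\<close> obeys the one-step
      recursion; \<open>image_chain_last\<close> identifies it with the marginal of the joint chain,
      however the users depend on each other.\<close>
    define N where "N t = map_pmf last (path_law (map_pmf (\<lambda>x. x $ i) (map_pmf fst \<nu>)) (P i) t)" for t
    have N: "N t = map_pmf (\<lambda>x. x $ i) (map_pmf last (path_law (map_pmf fst \<nu>) K t))" for t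
      unfolding N_def image_chain_last [OF users] ..
    have "set_pmf (N t) \<subseteq> {- 1, 1}" for t
      unfolding N set_map_pmf [of "\<lambda>x. x $ i"] using supp [of t] S by blast
    moreover have "N (Suc t) = bind_pmf (N t) (P i)" for t
      unfolding N_def by (rule last_path_law_Suc)
    ultimately have "bounded_partial_sums (\<lambda>t. measure_pmf.expectation (N t) real_of_int -
        (2 * generation_probability (p i) (q i) - 1))"
      using P nondegenerate by (intro two_state_mean_bounded_partial_sums [where Q = "P i"]) auto
    moreover have "X t i = measure_pmf.expectation (N t) real_of_int" for t
      unfolding N X_def by simp
    ultimately show ?thesis by (simp add: \<alpha>)
  qed
  \<comment> \<open>The solution of \<open>c 1 + c 2 = 0\<close> and
    \<open>c 2 - c 1 = 2 * (\<alpha> 2 - \<alpha> 1)\<close>.\<close>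
  define c :: "2 \<Rightarrow> real" where "c i = (if i = 1 then \<alpha> 1 - \<alpha> 2 else \<alpha> 2 - \<alpha> 1)" for i
  have contribution: "has_net_contribution K \<nu> \<phi> i (c i)"
    if \<phi>: "\<phi> \<in> efficient_policies S b_max" for \<phi> i
  proof -
    define A where
      "A t i = measure_pmf.expectation (action_law K \<nu> \<phi> t) (\<lambda>a. real_of_int (a $ i))" for t i
    have sum: "bounded_partial_sums (\<lambda>t. A t 1 + A t 2)"
      and diff: "bounded_partial_sums (\<lambda>t. (A t 2 - A t 1) - (X t 2 - X t 1))"
      unfolding A_def X_def
      using efficient_policy_drift_two_users [of K \<nu> b_max \<phi>, folded S, OF closed initial \<phi> even]
      by simp_all
    have "bounded_partial_sums (\<lambda>t. (A t 2 - A t 1) - (X t 2 - X t 1) +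
        ((X t 2 - (2 * \<alpha> 2 - 1)) + (- 1) * (X t 1 - (2 * \<alpha> 1 - 1))))"
      by (intro bounded_partial_sums_add bounded_partial_sums_cmult diff generation)
    then have diff': "bounded_partial_sums (\<lambda>t. A t 2 - A t 1 - 2 * (\<alpha> 2 - \<alpha> 1))"
      by (simp add: algebra_simps)
    \<comment> \<open>Each user's contribution is half the sum plus or minus half the difference;
      \<open>\<sigma>\<close> carries the sign.\<close>
    define \<sigma> :: real where "\<sigma> = (if i = 1 then - 1 / 2 else 1 / 2)"
    have "bounded_partial_sums (\<lambda>t. 1 / 2 * (A t 1 + A t 2) + \<sigma> * (A t 2 - A t 1 - 2 * (\<alpha> 2 - \<alpha> 1)))"
      by (intro bounded_partial_sums_add bounded_partial_sums_cmult sum diff')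
    moreover have "1 / 2 * (A t 1 + A t 2) + \<sigma> * (A t 2 - A t 1 - 2 * (\<alpha> 2 - \<alpha> 1)) = A t i - c i" for t
      using exhaust_2 [of i] unfolding \<sigma>_def c_def by (auto simp: field_simps)
    ultimately have "bounded_partial_sums (\<lambda>t. A t i - c i)" by simp
    then show ?thesis
      unfolding has_net_contribution_def average_contribution_def A_def
      by (rule average_tendsto_of_bounded_partial_sums)
  qed
  have Min_c: "Min (range c) = \<alpha> 2 - \<alpha> 1"
    using less unfolding UNIV_2 c_def by simp
  \<comment> \<open>By uniqueness of limits all efficient policies share the contributions
    \<open>c\<close>, so any one of them attains the maximum.\<close>
  have unique: "c' = c"
    if "\<phi> \<in> efficient_policies S b_max" "\<forall>i. has_net_contribution K \<nu> \<phi> i (c' i)" for \<phi> c'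
    using that contribution by (intro ext) (metis LIMSEQ_unique has_net_contribution_def)
  obtain \<phi>\<^sub>0 where "\<phi>\<^sub>0 \<in> efficient_policies S b_max"
    using efficient_policies_nonempty_two_users [of b_max] unfolding S by blast
  then have "is_maxmin_fair_value S b_max K \<nu> (\<alpha> 2 - \<alpha> 1)"
    unfolding is_maxmin_fair_value_def
  proof (intro conjI bexI exI ballI allI impI)
    show "has_net_contribution K \<nu> \<phi>\<^sub>0 i (c i)" for i
      using contribution \<open>\<phi>\<^sub>0 \<in> efficient_policies S b_max\<close> .
    show "\<alpha> 2 - \<alpha> 1 = Min (range c)" using Min_c ..
    show "Min (range c') \<le> \<alpha> 2 - \<alpha> 1"
      if "\<phi> \<in> efficient_policies S b_max" "\<forall>i. has_net_contribution K \<nu> \<phi> i (c' i)" for \<phi> c'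
      using unique [OF that] Min_c by simp
  qed
  then show ?thesis using contribution by blast
qed

end
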